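(* Let $G$ be a graph on $n$ vertices with adjacency matrix $\mathbf{A}$, let $0\neq x\in\mathbb{R}^n$, let $\mathbf{W}(x)=\begin{pmatrix}x&\mathbf{A}x&\mathbf{A}^2x&\cdots&\mathbf{A}^{n-1}x\end{pmatrix}$ be the $n\times n$ walk matrix, and let $\mathbf{U}$ be the (orthonormal) eigenvector matrix of $\mathbf{A}$. 1. If the characteristic polynomial $\varphi_{\mathbf{A}}$ is irreducible over $\mathbb{Q}$ and $x\in\mathbb{Q}^n$, then $\operatorname{rank}(\mathbf{W}(x))=n$. 2. For more general $0\neq x\in\mathbb{R}^n$, $\operatorname{rank}(\mathbf{W}(x))=\|\mathbf{U}^{*}x\|_0=\|\hat x\|_0$. 3. If all minors of $\mathbf{U}$ are nonvanishing, then $\operatorname{rank}(\mathbf{W}(x))\ge n+1-\|x\|_0$.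
   Context: Graphs are finite and simple, with vertex set $\{1,\dots,n\}$; the adjacency matrix $\mathbf{A}$ is the symmetric $0/1$ matrix with $\mathbf{A}_{v,w}=1$ if and only if $\{v,w\}$ is an edge. The orthonormal eigenvector matrix $\mathbf{U}\in\mathbb{R}^{n\times n}$ has as columns an orthonormal basis of eigenvectors of $\mathbf{A}$. $\hat x:=\mathbf{U}^{*}x$, and $\|y\|_0$ denotes the number of nonzero entries of a vector $y$. A minor is the determinant of a square submatrix of any size (arbitrary row and column index sets of equal size).
   Formalization: Parts 2 and 3 additionally assume that A has n distinct eigenvalues; without this both fail (empty graph on 2 vertices: part 2 with U = I, x = (1,1); part 3 with U the 45° rotation, x = e_1). *)

theory Defs
  imports
    "HOL-Computational_Algebra.Field_as_Ring"
    "Graph_Theory.Pair_Digraph"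
    "Jordan_Normal_Form.Char_Poly"
    "Jordan_Normal_Form.Spectral_Radius"
    "Jordan_Normal_Form.DL_Rank"
    "Jordan_Normal_Form.DL_Submatrix"
begin

(* Row and column i of a matrix (counted from 0) belong to vertex i + 1. The entry type is
   left open, so that the same 0/1 matrix can be read over the rationals and over the reals. *)
definition adjacency_matrix :: "nat \<Rightarrow> nat pair_pre_digraph \<Rightarrow> 'a::zero_neq_one mat" where
  "adjacency_matrix n G = mat n n (\<lambda>(i, j). if (Suc i, Suc j) \<in> parcs G then 1 else 0)"

definition walk_matrix :: "'a::comm_ring_1 mat \<Rightarrow> 'a vec \<Rightarrow> 'a mat" where
  "walk_matrix A x =
     mat_of_cols (dim_row A) (map (\<lambda>k. (A ^\<^sub>m k) *\<^sub>v x) [0..<dim_row A])"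

(* Being n orthonormal vectors in n-space, the columns automatically form a basis. *)
definition orthonormal_eigenvector_matrix :: "real mat \<Rightarrow> real mat \<Rightarrow> bool" where
  "orthonormal_eigenvector_matrix A U \<longleftrightarrow>
     U \<in> carrier_mat (dim_row A) (dim_row A) \<and>
     (\<forall>i<dim_row A. \<forall>j<dim_row A. col U i \<bullet> col U j = (if i = j then 1 else 0)) \<and>
     (\<forall>i<dim_row A. \<exists>\<mu>. eigenvector A (col U i) \<mu>)"

definition l0_norm :: "'a::zero vec \<Rightarrow> nat" where
  "l0_norm v = card {i. i < dim_vec v \<and> v $ i \<noteq> 0}"

definition all_minors_nonzero :: "'a::comm_ring_1 mat \<Rightarrow> bool" where
  "all_minors_nonzero M \<longleftrightarrow>
     (\<forall>I J. I \<subseteq> {..<dim_row M} \<and> J \<subseteq> {..<dim_col M} \<and> card I = card J \<longrightarrow>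
       det (submatrix M I J) \<noteq> 0)"

(* The number of distinct eigenvalues equals the size of the matrix. Without this, the orthonormal
   eigenvector matrix is not determined up to signs and column order, and the number of nonzero
   entries of the transform of a vector depends on the chosen basis. *)
definition distinct_eigenvalues :: "real mat \<Rightarrow> bool" where
  "distinct_eigenvalues A \<longleftrightarrow> card (spectrum A) = dim_row A"


(* An irreducible polynomial over the rationals is separable, so results stated for graphs with
   distinct eigenvalues cover those with irreducible characteristic polynomial. *)
lemma irreducible_imp_distinct_eigenvalues:
  fixes B :: "rat mat"
  assumes B: "B \<in> carrier_mat n n"
    and irr: "Factorial_Ring.irreducible (char_poly B)"
    and U: "orthonormal_eigenvector_matrix (map_mat of_rat B) U"
  shows "distinct_eigenvalues (map_mat of_rat B)"
proof -
  define A :: "real mat" where "A = map_mat of_rat B"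
  have A: "A \<in> carrier_mat n n" using B by (simp add: A_def)
  have dA: "dim_row A = n" using A by simp
  have Uc: "U \<in> carrier_mat n n"
    and orth: "\<And>i j. i < n \<Longrightarrow> j < n \<Longrightarrow> col U i \<bullet> col U j = (if i = j then 1 else 0)"
    and ev: "\<And>i. i < n \<Longrightarrow> \<exists>\<mu>. eigenvector A (col U i) \<mu>"
    using U dA unfolding orthonormal_eigenvector_matrix_def A_def[symmetric] by auto
  from ev obtain l where l: "\<And>i. i < n \<Longrightarrow> eigenvector A (col U i) (l i)" by metis
  define D where "D = mat n n (\<lambda>(i, j). if i = j then l i else (0::real))"
  have D: "D \<in> carrier_mat n n" by (simp add: D_def)
  have UtU: "U\<^sup>T * U = 1\<^sub>m n"
    using Uc orth by (intro eq_matI) auto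
  have UUt: "U * U\<^sup>T = 1\<^sub>m n"
    using mat_mult_left_right_inverse[OF _ Uc UtU] Uc by simp
  have AU: "A * U = U * D"
  proof (rule eq_matI)
    fix i j assume "i < dim_row (U * D)" "j < dim_col (U * D)"
    hence ij: "i < n" "j < n" using Uc D by auto
    have "(A * U) $$ (i, j) = (A *\<^sub>v col U j) $ i" using ij A Uc by simp
    also have "\<dots> = l j * U $$ (i, j)" using l[OF ij(2)] ij Uc by (simp add: eigenvector_def)
    also have "\<dots> = (\<Sum>k = 0..<n. U $$ (i, k) * D $$ (k, j))"
    proof -
      have "(\<Sum>k = 0..<n. U $$ (i, k) * D $$ (k, j)) = (\<Sum>k = 0..<n. if k = j then U $$ (i, j) * l j else 0)"
        using ij by (intro sum.cong) (auto simp: D_def)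
      thus ?thesis using ij by simp
    qed
    also have "\<dots> = (U * D) $$ (i, j)" using ij Uc D by (simp add: scalar_prod_def)
    finally show "(A * U) $$ (i, j) = (U * D) $$ (i, j)" .
  qed (use A Uc D in auto)
  have "A = A * (U * U\<^sup>T)" using A UUt by simp
  also have "\<dots> = U * D * U\<^sup>T" using A Uc AU by (metis assoc_mult_mat transpose_carrier_mat)
  finally have "A = U * D * U\<^sup>T" .
  hence "similar_mat A D"
    using A Uc D UtU UUt by (intro similar_matI[of _ _ U "U\<^sup>T" n]) auto
  moreover have "upper_triangular D" by (auto simp: D_def)
  ultimately have cp: "char_poly A = (\<Prod>a\<leftarrow>diag_mat D. [:- a, 1:])"
    using char_poly_similar char_poly_upper_triangular[OF D] by metis
  define p where "p = char_poly B"
  have degp: "degree p = n" using degree_monic_char_poly[OF B] by (simp add: p_def)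
  have n: "n \<noteq> 0"
  proof
    assume "n = 0"
    hence "is_unit p" using degp irr is_unit_iff_degree[of p]
      by (metis Factorial_Ring.irreducible_def p_def)
    thus False using irr unfolding p_def by (simp add: Factorial_Ring.irreducible_def)
  qed
  have "coprime p (pderiv p)"
  proof -
    have "\<not> p dvd pderiv p"
      using n degp dvd_imp_degree_le[of p "pderiv p"] pderiv_eq_0_iff[of p]
      by (auto simp: degree_pderiv)
    thus ?thesis using irr unfolding p_def[symmetric]
      by (metis Factorial_Ring.irreducibleD' coprimeI dvd_trans)
  qed
  then obtain u v where uv: "u * p + v * pderiv p = 1"
    using bezout_coefficients_fst_snd[of p "pderiv p"] by (metis coprime_iff_gcd_eq_1)
  have mp: "map_poly of_rat p = char_poly A"
    unfolding p_def A_def by (rule of_rat_hom.char_poly_hom[OF B, symmetric])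
  interpret h: map_poly_comm_ring_hom "of_rat :: rat \<Rightarrow> real" ..
  have pd: "map_poly of_rat (pderiv p) = pderiv (char_poly A)"
    unfolding mp[symmetric] by (rule poly_eqI) (simp add: coeff_pderiv of_rat_mult of_rat_add)
  have uvA: "map_poly of_rat u * char_poly A + map_poly of_rat v * pderiv (char_poly A) = 1"
    unfolding mp[symmetric] using arg_cong[OF uv, of "map_poly (of_rat :: rat \<Rightarrow> real)"] pd mp
    by (simp add: h.hom_add h.hom_mult)
  have "distinct (diag_mat D)"
  proof (rule ccontr)
    assume "\<not> distinct (diag_mat D)"
    then obtain xs ys zs y where "diag_mat D = xs @ [y] @ ys @ [y] @ zs"
      using not_distinct_decomp by blast
    hence "char_poly A = [:- y, 1:] * ([:- y, 1:] *
        ((\<Prod>a\<leftarrow>xs. [:- a, 1:]) * (\<Prod>a\<leftarrow>ys. [:- a, 1:]) * (\<Prod>a\<leftarrow>zs. [:- a, 1:])))"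
      unfolding cp by (simp only: map_append prod_list.append list.map prod_list.Cons prod_list.Nil
          mult.left_commute mult.commute mult.assoc mult_1_right)
    then obtain q where q: "char_poly A = [:- y, 1:] * ([:- y, 1:] * q)" by blast
    have "poly (char_poly A) y = 0" "poly (pderiv (char_poly A)) y = 0"
      unfolding q pderiv_mult by simp_all
    with arg_cong[OF uvA, of "\<lambda>r. poly r y"] show False by simp
  qed
  moreover have "spectrum A = set (diag_mat D)"
    unfolding spectrum_root_char_poly[OF A] cp by (auto simp: poly_prod_list prod_list_zero_iff)
  moreover have "length (diag_mat D) = n" by (simp add: diag_mat_def D_def)
  ultimately have "card (spectrum A) = n" by (simp add: distinct_card)
  thus ?thesis using dA unfolding distinct_eigenvalues_def A_def by simp
qed

corollary irreducible_adjacency_matrix_imp_distinct_eigenvalues: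
  assumes "Factorial_Ring.irreducible (char_poly (adjacency_matrix n G :: rat mat))"
    and "orthonormal_eigenvector_matrix (adjacency_matrix n G) U"
  shows "distinct_eigenvalues (adjacency_matrix n G)"
proof -
  have "map_mat of_rat (adjacency_matrix n G :: rat mat) = (adjacency_matrix n G :: real mat)"
    by (rule eq_matI) (auto simp: adjacency_matrix_def)
  moreover have "(adjacency_matrix n G :: rat mat) \<in> carrier_mat n n"
    by (simp add: adjacency_matrix_def)
  ultimately show ?thesis
    using irreducible_imp_distinct_eigenvalues[of "adjacency_matrix n G" n U] assms by simp
qed

end

theory Submission
  imports Defs
begin

text \<open>
  Write \<open>xh = U\<^sup>T x\<close> and let \<open>l i\<close> be the eigenvalue of column \<open>i\<close> of \<open>U\<close>. In eigencoordinates
  applying \<open>A\<close> is multiplying coordinate \<open>i\<close> by \<open>l i\<close>, so a combination \<open>\<Sum>k. c k A^k x\<close>, which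
  is \<open>p(A) x\<close> for the polynomial \<open>p\<close> with coefficients \<open>c\<close>, has coordinates \<open>p(l i) xh i\<close>. Linear
  relations between the columns of the walk matrix are therefore exactly the polynomials that vanish
  at every \<open>l i\<close> with \<open>xh i \<noteq> 0\<close>. The three claims are readings of this fact.

  \<^item> If \<open>x\<close> is rational, so is the walk matrix, and if that were singular there would be a relation
    with rational \<open>p \<noteq> 0\<close> of degree below \<open>n\<close>. An irreducible characteristic polynomial is coprime to
    \<open>p\<close>, yet both vanish at \<open>l i\<close> for any \<open>i\<close> with \<open>xh i \<noteq> 0\<close>, and such an \<open>i\<close> exists since \<open>U\<close> is
    invertible: a contradiction with Bezout's identity (\<open>rank_krylov_rational\<close>).

  \<^item> Let \<open>r\<close> be the number of nonzero \<open>xh i\<close>. The walk matrix is a sum of \<open>r\<close> matrices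
    \<open>xh i u\<^sub>i v\<^sub>i\<^sup>T\<close>, with \<open>u\<^sub>i\<close> the column \<open>i\<close> of \<open>U\<close> and \<open>v\<^sub>i\<close> the vector of powers of \<open>l i\<close>, each of
    rank one, so its rank is at most \<open>r\<close>. When the eigenvalues are distinct, a
    relation between the first \<open>r\<close> columns is a polynomial of degree below \<open>r\<close> with \<open>r\<close> roots, hence
    zero, so these columns are independent (\<open>rank_krylov_eq_transform_support\<close>).

  \<^item> If \<open>x\<close> and \<open>xh\<close> together had at most \<open>n\<close> nonzero entries, then \<open>xh\<close> would vanish on at least as
    many indices as \<open>x\<close> has support; the square submatrix of \<open>U\<close> with rows in the support of \<open>x\<close> and
    columns among those indices would have a nonzero left kernel vector and vanishing determinant
    (\<open>uncertainty_principle\<close>). With the second item this bounds the rank from below.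
\<close>

section \<open>Bounds on the rank of a matrix\<close>

text \<open>
  Each index \<open>i\<close> contributes a matrix of rank at most one, and rank is subadditive.
\<close>

lemma (in vec_space) rank_sum_of_products_le:
  assumes "finite S" and "W \<in> carrier_mat n nc"
    and "\<And>a k. a < n \<Longrightarrow> k < nc \<Longrightarrow> W $$ (a, k) = (\<Sum>i\<in>S. f i a * g i k)"
  shows "rank W \<le> card S"
  using assms
proof (induction S arbitrary: W rule: finite_induct)
  case empty
  have "W = 0\<^sub>m n nc" using empty by (intro eq_matI) auto
  then show ?case using rank_0I by simp
next
  case (insert s S)
  define P where "P = mat n nc (\<lambda>(a, k). f s a * g s k)"
  define Q where "Q = mat n nc (\<lambda>(a, k). \<Sum>i\<in>S. f i a * g i k)"
  have P: "P \<in> carrier_mat n nc" and Q: "Q \<in> carrier_mat n nc"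
    by (simp_all add: P_def Q_def)
  have "W = P + Q"
    using insert by (intro eq_matI) (auto simp: P_def Q_def)
  moreover have "rank P \<le> 1"
    by (rule rank_le_1_product_entries[OF P]) (auto simp: P_def)
  moreover have "rank Q \<le> card S"
    by (rule insert.IH[OF Q]) (auto simp: Q_def)
  ultimately show ?case
    using rank_subadditive[OF P Q] insert.hyps by simp
qed

text \<open>
  The rank is defined through the set of columns, which forgets repetitions. A repeated column would
  put the difference of two unit vectors into the kernel, so a trivial kernel makes the \<open>r\<close> columns
  distinct as well as independent.
\<close>

lemma (in vec_space) le_rank_if_trivial_kernel:
  assumes W: "W \<in> carrier_mat n nc" and B: "B \<in> carrier_mat n r"
    and sub: "set (cols B) \<subseteq> set (cols W)"
    and ker: "\<And>c. c \<in> carrier_vec r \<Longrightarrow> B *\<^sub>v c = 0\<^sub>v n \<Longrightarrow> c = 0\<^sub>v r"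
  shows "r \<le> rank W"
proof -
  have dist: "distinct (cols B)"
  proof (rule ccontr)
    assume "\<not> distinct (cols B)"
    then obtain i j where ij: "i < r" "j < r" "i \<noteq> j" "col B i = col B j"
      using B by (auto simp: distinct_conv_nth)
    have unit: "B *\<^sub>v unit_vec r k = col B k" if "k < r" for k
      using B that by (intro eq_vecI) auto
    have "B *\<^sub>v (unit_vec r i - unit_vec r j) = B *\<^sub>v unit_vec r i - B *\<^sub>v unit_vec r j"
      using B by (intro mult_minus_distrib_mat_vec) auto
    also have "\<dots> = col B i - col B j"
      using unit ij by simp
    also have "\<dots> = 0\<^sub>v n" using B ij by auto
    finally have "unit_vec r i - unit_vec r j = (0\<^sub>v r :: 'a vec)"
      using ker by simp
    from arg_cong[OF this, of "\<lambda>v. v $ i"] show False using ij by simp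
  qed
  have "lin_indpt (set (cols B))"
    using lin_depE[OF B _ dist] ker by blast
  then have "card (set (cols B)) \<le> rank W"
    by (rule rank_ge_card_indpt[OF W sub])
  then show ?thesis using dist B by (simp add: distinct_card)
qed

section \<open>Krylov matrices\<close>

text \<open>
  The walk matrix is the case \<open>r = dim_row A\<close>; narrower ones serve to exhibit independent columns.
\<close>

definition krylov_matrix :: "'a::comm_ring_1 mat \<Rightarrow> 'a vec \<Rightarrow> nat \<Rightarrow> 'a mat" where
  "krylov_matrix A x r = mat_of_cols (dim_row A) (map (\<lambda>k. (A ^\<^sub>m k) *\<^sub>v x) [0..<r])"

text \<open>
  A coefficient vector \<open>c\<close> of a combination of Krylov columns is read as the polynomial \<open>p\<close> for which
  that combination is \<open>p(A) x\<close>.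
\<close>

definition vec_poly :: "'a::comm_ring_1 vec \<Rightarrow> 'a poly" where
  "vec_poly c = (\<Sum>k<dim_vec c. monom (c $ k) k)"

lemma coeff_vec_poly: "coeff (vec_poly c) k = (if k < dim_vec c then c $ k else 0)"
  by (simp add: vec_poly_def coeff_sum)

lemma poly_vec_poly: "poly (vec_poly c) z = (\<Sum>k<dim_vec c. c $ k * z ^ k)"
  by (simp add: vec_poly_def poly_sum poly_monom)

lemma vec_poly_eq_0_iff: "vec_poly c = 0 \<longleftrightarrow> c = 0\<^sub>v (dim_vec c)"
proof
  assume "vec_poly c = 0"
  then show "c = 0\<^sub>v (dim_vec c)"
    by (metis coeff_0 coeff_vec_poly eq_vecI index_zero_vec)
next
  assume c: "c = 0\<^sub>v (dim_vec c)"
  show "vec_poly c = 0"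
    by (rule poly_eqI, subst c) (simp add: coeff_vec_poly)
qed

lemma degree_vec_poly_less:
  assumes "vec_poly c \<noteq> 0"
  shows "degree (vec_poly c) < dim_vec c"
  using assms coeff_vec_poly[of c "degree (vec_poly c)"]
  by (metis leading_coeff_0_iff)

lemma krylov_matrix_carrier [simp]:
  "A \<in> carrier_mat n n \<Longrightarrow> krylov_matrix A x r \<in> carrier_mat n r"
  by (simp add: krylov_matrix_def mat_of_cols_def)

lemma krylov_matrix_index:
  assumes "A \<in> carrier_mat n n" "a < n" "k < r"
  shows "krylov_matrix A x r $$ (a, k) = ((A ^\<^sub>m k) *\<^sub>v x) $ a"
  using assms by (simp add: krylov_matrix_def mat_of_cols_index)

lemma cols_krylov_matrix:
  assumes "A \<in> carrier_mat n n" "x \<in> carrier_vec n"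
  shows "cols (krylov_matrix A x r) = map (\<lambda>k. (A ^\<^sub>m k) *\<^sub>v x) [0..<r]"
  using assms unfolding krylov_matrix_def
  by (intro cols_mat_of_cols) (use mult_mat_vec_carrier[OF pow_carrier_mat[OF assms(1)] assms(2)] in auto)

section \<open>The spectral decomposition of a Krylov matrix\<close>

locale symmetric_eigenbasis =
  fixes n :: nat and A U :: "real mat" and l :: "nat \<Rightarrow> real"
  assumes A: "A \<in> carrier_mat n n" and sym: "transpose_mat A = A"
    and U: "U \<in> carrier_mat n n" and UtU: "transpose_mat U * U = 1\<^sub>m n"
    and eigen: "\<And>i. i < n \<Longrightarrow> A *\<^sub>v col U i = l i \<cdot>\<^sub>v col U i"
begin

lemma UUt: "U * transpose_mat U = 1\<^sub>m n"
  using mat_mult_left_right_inverse[OF _ U UtU] U by simp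

lemma reconstruct:
  assumes "y \<in> carrier_vec n"
  shows "U *\<^sub>v (transpose_mat U *\<^sub>v y) = y"
proof -
  have "U *\<^sub>v (transpose_mat U *\<^sub>v y) = (U * transpose_mat U) *\<^sub>v y"
    using assms U by (intro assoc_mult_mat_vec[symmetric]) auto
  then show ?thesis using assms by (simp add: UUt)
qed

text \<open>
  Symmetry moves \<open>A\<close> to the other side of the inner product, where it meets its own eigenvector.
\<close>

lemma transform_mult:
  assumes y: "y \<in> carrier_vec n" and i: "i < n"
  shows "(transpose_mat U *\<^sub>v (A *\<^sub>v y)) $ i = l i * (transpose_mat U *\<^sub>v y) $ i"
proof -
  have u: "col U i \<in> carrier_vec n" using U i by auto
  have "(transpose_mat U *\<^sub>v (A *\<^sub>v y)) $ i = col U i \<bullet> (A *\<^sub>v y)"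
    using U i by simp
  also have "\<dots> = (A *\<^sub>v col U i) \<bullet> y"
    using transpose_vec_mult_scalar[OF A y u] sym by simp
  also have "\<dots> = l i * (col U i \<bullet> y)"
    using eigen[OF i] y u by simp
  finally show ?thesis using U i by simp
qed

lemma transform_pow:
  assumes x: "x \<in> carrier_vec n" and i: "i < n"
  shows "(transpose_mat U *\<^sub>v ((A ^\<^sub>m k) *\<^sub>v x)) $ i = l i ^ k * (transpose_mat U *\<^sub>v x) $ i"
  using x
proof (induction k arbitrary: x)
  case 0
  then show ?case using A by simp
next
  case (Suc k)
  have P: "A ^\<^sub>m k \<in> carrier_mat n n" using A by simp
  have "(A ^\<^sub>m Suc k) *\<^sub>v x = (A ^\<^sub>m k) *\<^sub>v (A *\<^sub>v x)"
    using assoc_mult_mat_vec[OF P A Suc.prems] by simp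
  then show ?case
    using Suc.IH[of "A *\<^sub>v x"] A Suc.prems transform_mult[OF Suc.prems i] by simp
qed

text \<open>
  Expanding \<open>A^k x\<close> in the eigenbasis separates the row index from the column index in each summand,
  which is what bounds the rank of a Krylov matrix by the size of the support of the transform.
\<close>

lemma krylov_matrix_expansion:
  assumes x: "x \<in> carrier_vec n" and a: "a < n" and k: "k < r"
  shows "krylov_matrix A x r $$ (a, k) =
    (\<Sum>i | i < n \<and> (transpose_mat U *\<^sub>v x) $ i \<noteq> 0.
        U $$ (a, i) * (l i ^ k * (transpose_mat U *\<^sub>v x) $ i))"
proof -
  define y where "y = (A ^\<^sub>m k) *\<^sub>v x"
  have y: "y \<in> carrier_vec n" unfolding y_def
    using A x by (metis mult_mat_vec_carrier pow_carrier_mat)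
  have "krylov_matrix A x r $$ (a, k) = (U *\<^sub>v (transpose_mat U *\<^sub>v y)) $ a"
    using reconstruct[OF y] krylov_matrix_index[OF A a k] y_def by simp
  also have "\<dots> = (\<Sum>i<n. U $$ (a, i) * (transpose_mat U *\<^sub>v y) $ i)"
    using U a by (simp add: scalar_prod_def lessThan_atLeast0)
  also have "\<dots> = (\<Sum>i<n. U $$ (a, i) * (l i ^ k * (transpose_mat U *\<^sub>v x) $ i))"
    unfolding y_def by (intro sum.cong refl) (simp only: transform_pow[OF x] lessThan_iff)
  also have "\<dots> = (\<Sum>i | i < n \<and> (transpose_mat U *\<^sub>v x) $ i \<noteq> 0.
        U $$ (a, i) * (l i ^ k * (transpose_mat U *\<^sub>v x) $ i))"
    by (rule sum.mono_neutral_right) auto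
  finally show ?thesis .
qed

text \<open>
  The central identity: in eigencoordinates \<open>p(A)\<close> acts as multiplication by \<open>p(l i)\<close>.
\<close>

lemma transform_krylov_combination:
  assumes x: "x \<in> carrier_vec n" and c: "c \<in> carrier_vec r" and i: "i < n"
  shows "(transpose_mat U *\<^sub>v (krylov_matrix A x r *\<^sub>v c)) $ i =
    poly (vec_poly c) (l i) * (transpose_mat U *\<^sub>v x) $ i"
proof -
  have K: "krylov_matrix A x r \<in> carrier_mat n r" using A by simp
  define M where "M = transpose_mat U * krylov_matrix A x r"
  have M: "M \<in> carrier_mat n r" using U K by (simp add: M_def)
  have entry: "M $$ (i, k) = l i ^ k * (transpose_mat U *\<^sub>v x) $ i"
    if k: "k < r" for k
  proof -
    have P: "(A ^\<^sub>m k) *\<^sub>v x \<in> carrier_vec n"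
      using A x by (metis mult_mat_vec_carrier pow_carrier_mat)
    have "col (krylov_matrix A x r) k = (A ^\<^sub>m k) *\<^sub>v x"
      using K k cols_krylov_matrix[OF A x, of r]
      by (metis (no_types, lifting) carrier_matD(2) cols_length cols_nth diff_zero length_map
          length_upt nth_map nth_upt add_0)
    then show ?thesis using U K i k transform_pow[OF x i, of k] by (simp add: M_def)
  qed
  have "transpose_mat U *\<^sub>v (krylov_matrix A x r *\<^sub>v c) = M *\<^sub>v c"
    unfolding M_def using U K c by (intro assoc_mult_mat_vec[symmetric]) auto
  then have "(transpose_mat U *\<^sub>v (krylov_matrix A x r *\<^sub>v c)) $ i =
      (\<Sum>k<r. M $$ (i, k) * c $ k)"
    using M c i by (simp add: scalar_prod_def lessThan_atLeast0)
  also have "\<dots> = (\<Sum>k<r. (c $ k * l i ^ k) * (transpose_mat U *\<^sub>v x) $ i)"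
    by (intro sum.cong refl) (simp only: entry lessThan_iff mult_ac)
  finally show ?thesis
    using c by (simp add: poly_vec_poly sum_distrib_right)
qed

lemma krylov_kernel_imp_root:
  assumes "x \<in> carrier_vec n" "c \<in> carrier_vec r" "krylov_matrix A x r *\<^sub>v c = 0\<^sub>v n"
    and "i < n" "(transpose_mat U *\<^sub>v x) $ i \<noteq> 0"
  shows "poly (vec_poly c) (l i) = 0"
  using transform_krylov_combination[OF assms(1,2,4)] assms(3-5) U by simp

lemma transform_nonzero:
  assumes x: "x \<in> carrier_vec n" "x \<noteq> 0\<^sub>v n"
  obtains i where "i < n" "(transpose_mat U *\<^sub>v x) $ i \<noteq> 0"
proof (rule ccontr)
  assume *: "\<not> thesis"
  have "transpose_mat U *\<^sub>v x = 0\<^sub>v n"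
    using * that U by (intro eq_vecI) auto
  then have "x = U *\<^sub>v 0\<^sub>v n" using reconstruct[OF x(1)] by simp
  also have "\<dots> = 0\<^sub>v n" using U by auto
  finally show False using x by simp
qed

text \<open>
  The upper bound is the expansion into rank-one terms. For the lower bound the first \<open>r\<close> columns,
  with \<open>r\<close> the size of the support, are independent: a relation between them would be a nonzero
  polynomial of degree below \<open>r\<close> vanishing at \<open>r\<close> different eigenvalues.
\<close>

lemma rank_krylov_eq_transform_support:
  assumes x: "x \<in> carrier_vec n" and inj: "inj_on l {..<n}"
  shows "vec_space.rank n (krylov_matrix A x n) = l0_norm (transpose_mat U *\<^sub>v x)"
proof (rule antisym)
  define S where "S = {i. i < n \<and> (transpose_mat U *\<^sub>v x) $ i \<noteq> 0}"
  have S: "l0_norm (transpose_mat U *\<^sub>v x) = card S" "S \<subseteq> {..<n}" "finite S"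
    using U by (auto simp: l0_norm_def S_def)
  have K: "krylov_matrix A x n \<in> carrier_mat n n" using A by simp
  show "vec_space.rank n (krylov_matrix A x n) \<le> l0_norm (transpose_mat U *\<^sub>v x)"
    unfolding S(1)
    by (rule vec_space.rank_sum_of_products_le[OF S(3) K])
      (unfold S_def, rule krylov_matrix_expansion[OF x], auto)
  define r where "r = card S"
  have "r \<le> n" using card_mono[OF _ S(2)] by (simp add: r_def)
  have "r \<le> vec_space.rank n (krylov_matrix A x n)"
  proof (rule vec_space.le_rank_if_trivial_kernel[OF K])
    show "krylov_matrix A x r \<in> carrier_mat n r" using A by simp
    show "set (cols (krylov_matrix A x r)) \<subseteq> set (cols (krylov_matrix A x n))"
      using \<open>r \<le> n\<close> by (auto simp: cols_krylov_matrix[OF A x])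
    fix c :: "real vec" assume c: "c \<in> carrier_vec r" "krylov_matrix A x r *\<^sub>v c = 0\<^sub>v n"
    have roots: "l ` S \<subseteq> {z. poly (vec_poly c) z = 0}"
      using krylov_kernel_imp_root[OF x c] by (auto simp: S_def)
    have "vec_poly c = 0"
    proof (rule ccontr)
      assume nz: "vec_poly c \<noteq> 0"
      have "r = card (l ` S)"
        using inj_on_subset[OF inj S(2)] by (simp add: card_image r_def)
      also have "\<dots> \<le> card {z. poly (vec_poly c) z = 0}"
        using roots poly_roots_finite[OF nz] by (intro card_mono)
      also have "\<dots> \<le> degree (vec_poly c)" by (rule card_poly_roots_bound[OF nz])
      also have "\<dots> < r" using degree_vec_poly_less[OF nz] c by simp
      finally show False by simp
    qed
    then show "c = 0\<^sub>v r" using c by (simp add: vec_poly_eq_0_iff)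
  qed
  then show "l0_norm (transpose_mat U *\<^sub>v x) \<le> vec_space.rank n (krylov_matrix A x n)"
    using S(1) by (simp add: r_def)
qed

text \<open>
  An eigenvector for any value \<open>m\<close> has some nonzero eigencoordinate \<open>i\<close>, and there \<open>A\<close> multiplies by
  both \<open>m\<close> and \<open>l i\<close>; so the chosen basis already displays all eigenvalues.
\<close>

lemma spectrum_eq: "spectrum A = l ` {..<n}"
proof
  show "l ` {..<n} \<subseteq> spectrum A"
  proof (rule image_subsetI)
    fix i assume i: "i \<in> {..<n}"
    have "col U i \<bullet> col U i = 1"
      using arg_cong[OF UtU, of "\<lambda>M. M $$ (i, i)"] i U by simp
    then have "col U i \<noteq> 0\<^sub>v n" using U i by auto
    then have "eigenvector A (col U i) (l i)"
      using eigen i U A by (auto simp: eigenvector_def)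
    then show "l i \<in> spectrum A" by (auto simp: spectrum_def eigenvalue_def)
  qed
  show "spectrum A \<subseteq> l ` {..<n}"
  proof
    fix m assume "m \<in> spectrum A"
    then obtain v where v: "v \<in> carrier_vec n" "v \<noteq> 0\<^sub>v n" "A *\<^sub>v v = m \<cdot>\<^sub>v v"
      using A by (auto simp: spectrum_def eigenvalue_def eigenvector_def)
    obtain i where i: "i < n" "(transpose_mat U *\<^sub>v v) $ i \<noteq> 0"
      using transform_nonzero[OF v(1,2)] .
    have "m * (transpose_mat U *\<^sub>v v) $ i = l i * (transpose_mat U *\<^sub>v v) $ i"
      using transform_mult[OF v(1) i(1)] v i U by simp
    then show "m \<in> l ` {..<n}" using i by simp
  qed
qed

lemma inj_on_eigenvalues:
  assumes "distinct_eigenvalues A"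
  shows "inj_on l {..<n}"
  using assms A by (intro eq_card_imp_inj_on) (simp_all add: distinct_eigenvalues_def spectrum_eq)

section \<open>Rational starting vectors\<close>

text \<open>
  Rationality of \<open>x\<close> makes the kernel vector of a singular Krylov matrix rational too, which is
  where irreducibility over the rationals can be used: the resulting polynomial has degree below
  \<open>n\<close>, so it is coprime to the characteristic polynomial and cannot share the root \<open>l i\<close> with it.
\<close>

lemma rank_krylov_rational:
  fixes B :: "rat mat"
  assumes B: "B \<in> carrier_mat n n" and AB: "A = map_mat of_rat B"
    and irr: "Factorial_Ring.irreducible (char_poly B)"
    and x: "x \<in> carrier_vec n" "x \<noteq> 0\<^sub>v n" and rat: "\<forall>i<n. x $ i \<in> \<rat>"
  shows "vec_space.rank n (krylov_matrix A x n) = n"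
proof -
  have K: "krylov_matrix A x n \<in> carrier_mat n n" using A by simp
  obtain q where q: "\<And>i. i < n \<Longrightarrow> x $ i = of_rat (q i)"
  proof -
    have "\<forall>i. \<exists>r. i < n \<longrightarrow> x $ i = of_rat r" using rat by (meson Rats_cases)
    then show ?thesis using that by metis
  qed
  define y where "y = vec n q"
  have y: "y \<in> carrier_vec n" and xy: "x = map_vec of_rat y"
    using q x by (auto simp: y_def)
  have pow: "(A ^\<^sub>m k) *\<^sub>v x = map_vec of_rat ((B ^\<^sub>m k) *\<^sub>v y)" for k
    unfolding xy AB of_rat_hom.mat_hom_pow[OF B, symmetric]
    by (rule of_rat_hom.mult_mat_vec_hom[OF pow_carrier_mat[OF B] y, symmetric])
  have KB: "krylov_matrix A x n = map_mat of_rat (krylov_matrix B y n)"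
  proof (rule eq_matI)
    fix a k assume "a < dim_row (map_mat of_rat (krylov_matrix B y n) :: real mat)"
      "k < dim_col (map_mat of_rat (krylov_matrix B y n) :: real mat)"
    then have ak: "a < n" "k < n" using krylov_matrix_carrier[OF B, of y n] by auto
    have "dim_vec ((B ^\<^sub>m k) *\<^sub>v y) = n"
      using carrier_matD(1)[OF pow_carrier_mat[OF B, of k]] by (simp only: dim_mult_mat_vec)
    then show "krylov_matrix A x n $$ (a, k) = map_mat of_rat (krylov_matrix B y n) $$ (a, k)"
      using ak krylov_matrix_carrier[OF B, of y n]
      by (simp add: krylov_matrix_index[OF A] krylov_matrix_index[OF B] pow)
  qed (use A B in \<open>simp_all add: krylov_matrix_def\<close>)
  have "det (krylov_matrix B y n) \<noteq> 0"
  proof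
    have KBc: "krylov_matrix B y n \<in> carrier_mat n n" using B by simp
    assume "det (krylov_matrix B y n) = 0"
    then obtain c where c: "c \<in> carrier_vec n" "c \<noteq> 0\<^sub>v n" "krylov_matrix B y n *\<^sub>v c = 0\<^sub>v n"
      using det_0_iff_vec_prod_zero_field[OF KBc] by blast
    define p where "p = vec_poly c"
    have p0: "p \<noteq> 0" using c by (simp add: p_def vec_poly_eq_0_iff)
    have degp: "degree p < n" using degree_vec_poly_less[of c] p0 c by (simp add: p_def)
    have "\<not> char_poly B dvd p"
      using dvd_imp_degree_le[OF _ p0] degp degree_monic_char_poly[OF B] by fastforce
    then have "coprime (char_poly B) p"
      using irr by (metis Factorial_Ring.irreducibleD' coprimeI dvd_trans)
    then obtain u v where uv: "u * char_poly B + v * p = 1"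
      using bezout_coefficients_fst_snd[of "char_poly B" p] by (metis coprime_iff_gcd_eq_1)
    interpret h: map_poly_comm_ring_hom "of_rat :: rat \<Rightarrow> real" ..
    have cp: "char_poly A = map_poly of_rat (char_poly B)"
      unfolding AB by (rule of_rat_hom.char_poly_hom[OF B])
    \<comment> \<open>Bezout's identity is carried over to the reals, where the common root lives.\<close>
    have bez: "map_poly of_rat u * char_poly A + map_poly of_rat v * map_poly of_rat p = 1"
      using arg_cong[OF uv, of "map_poly (of_rat :: rat \<Rightarrow> real)"]
      by (simp add: h.hom_add h.hom_mult cp)
    have mp: "map_poly of_rat p = vec_poly (map_vec of_rat c :: real vec)"
      by (rule poly_eqI) (simp add: p_def coeff_vec_poly)
    have "krylov_matrix A x n *\<^sub>v map_vec of_rat c = 0\<^sub>v n"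
      unfolding KB of_rat_hom.mult_mat_vec_hom[OF KBc c(1), symmetric] c(3)
      by (rule eq_vecI) auto
    moreover obtain i where i: "i < n" "(transpose_mat U *\<^sub>v x) $ i \<noteq> 0"
      using transform_nonzero[OF x] .
    ultimately have "poly (map_poly of_rat p) (l i) = 0"
      unfolding mp using c by (intro krylov_kernel_imp_root[OF x(1)]) auto
    moreover have "poly (char_poly A) (l i) = 0"
      using spectrum_eq spectrum_root_char_poly[OF A] i by auto
    ultimately show False
      using arg_cong[OF bez, of "\<lambda>r. poly r (l i)"] by simp
  qed
  then have "det (krylov_matrix A x n) \<noteq> 0"
    by (simp add: KB)
  then show ?thesis using vec_space.det_rank_iff[OF K] by simp
qed

end

section \<open>The uncertainty principle for matrices without vanishing minors\<close>

lemma bij_betw_pick: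
  assumes "finite I"
  shows "bij_betw (pick I) {..<card I} I"
proof -
  have "inj_on (pick I) {..<card I}"
    by (intro linorder_inj_onI) (auto dest!: pick_mono[OF disjI1])
  moreover have "pick I ` {..<card I} \<subseteq> I"
    using pick_in_set by auto
  ultimately show ?thesis
    using assms by (simp add: bij_betw_def card_image card_subset_eq)
qed

text \<open>
  If the bound failed, \<open>xh = U\<^sup>T x\<close> would have at least as many zeros as \<open>x\<close> has nonzero
  entries, so a square submatrix can be cut out of \<open>U\<close> whose rows are the support of \<open>x\<close> and whose
  columns are zeros of \<open>xh\<close>. The restriction of \<open>x\<close> to its support then loses no summand of these
  coordinates of \<open>xh\<close>, and is a nonzero vector in the left kernel of that submatrix.
\<close>

lemma uncertainty_principle:
  fixes U :: "'a::field mat"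
  assumes U: "U \<in> carrier_mat n n" and minors: "all_minors_nonzero U"
    and x: "x \<in> carrier_vec n" "x \<noteq> 0\<^sub>v n"
  shows "n + 1 \<le> l0_norm (transpose_mat U *\<^sub>v x) + l0_norm x"
proof (rule ccontr)
  assume less: "\<not> ?thesis"
  define J where "J = {j. j < n \<and> x $ j \<noteq> 0}"
  define S where "S = {i. i < n \<and> (transpose_mat U *\<^sub>v x) $ i \<noteq> 0}"
  have J: "J \<subseteq> {..<n}" "finite J" and S: "S \<subseteq> {..<n}" by (auto simp: J_def S_def)
  have norms: "l0_norm x = card J" "l0_norm (transpose_mat U *\<^sub>v x) = card S"
    using U x by (simp_all add: l0_norm_def J_def S_def)
  have "card J \<le> card ({..<n} - S)"
    using less norms S by (simp add: card_Diff_subset finite_subset)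
  then obtain I where I: "I \<subseteq> {..<n} - S" "card I = card J" "finite I"
    using obtain_subset_with_card_n by metis
  define s where "s = card J"
  have s: "card {i. i < n \<and> i \<in> I} = s" "card {j. j < n \<and> j \<in> J} = s"
  proof -
    have "{i. i < n \<and> i \<in> I} = I" "{j. j < n \<and> j \<in> J} = J" using I J by auto
    then show "card {i. i < n \<and> i \<in> I} = s" "card {j. j < n \<and> j \<in> J} = s"
      using I by (simp_all add: s_def)
  qed
  define M where "M = submatrix U J I"
  have M: "M \<in> carrier_mat s s"
    using s U by (intro carrier_matI) (simp_all add: M_def dim_submatrix)
  have "det M \<noteq> 0"
    using minors[unfolded all_minors_nonzero_def, rule_format, of J I] I J U by (auto simp: M_def)
  then have detT: "det (transpose_mat M) \<noteq> 0"
    using det_transpose[OF M] by simp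
  define y where "y = vec s (\<lambda>a. x $ pick J a)"
  have y: "y \<in> carrier_vec s" by (simp add: y_def)
  have "transpose_mat M *\<^sub>v y = 0\<^sub>v s"
  proof (rule eq_vecI)
    fix b assume "b < dim_vec (0\<^sub>v s)"
    then have b: "b < s" by simp
    define i where "i = pick I b"
    have "i \<in> I" using pick_in_set[of b I] b I by (simp add: i_def s_def)
    then have i: "i < n" "(transpose_mat U *\<^sub>v x) $ i = 0" using I by (auto simp: S_def)
    have "(transpose_mat M *\<^sub>v y) $ b = (\<Sum>a<s. M $$ (a, b) * x $ pick J a)"
      using M b by (simp add: scalar_prod_def y_def lessThan_atLeast0)
    also have "\<dots> = (\<Sum>a<s. U $$ (pick J a, i) * x $ pick J a)"
      using b s U by (intro sum.cong refl) (simp add: M_def submatrix_index i_def)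
    also have "\<dots> = (\<Sum>j\<in>J. U $$ (j, i) * x $ j)"
      unfolding s_def
      by (rule sum.reindex_bij_betw[OF bij_betw_pick[OF J(2)], of "\<lambda>j. U $$ (j, i) * x $ j"])
    also have "\<dots> = (\<Sum>j<n. U $$ (j, i) * x $ j)"
      using J by (intro sum.mono_neutral_left) (auto simp: J_def)
    also have "\<dots> = (transpose_mat U *\<^sub>v x) $ i"
      using U x i by (simp add: scalar_prod_def lessThan_atLeast0)
    finally show "(transpose_mat M *\<^sub>v y) $ b = 0\<^sub>v s $ b" using i b by simp
  qed (use M in simp)
  moreover have "y \<noteq> 0\<^sub>v s"
  proof
    assume y0: "y = 0\<^sub>v s"
    obtain j where "j < n" "x $ j \<noteq> 0" using x by (metis carrier_vecD eq_vecI index_zero_vec)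
    then have "s > 0" using J by (auto simp: s_def card_gt_0_iff J_def)
    then have "pick J 0 \<in> J" using pick_in_set[of 0 J] by (simp add: s_def)
    moreover have "x $ pick J 0 = 0" using arg_cong[OF y0, of "\<lambda>v. v $ 0"] \<open>s > 0\<close> by (simp add: y_def)
    ultimately show False by (simp add: J_def)
  qed
  ultimately show False
    using detT det_0_iff_vec_prod_zero_field[of "transpose_mat M" s] M y by auto
qed

section \<open>Walk matrices of graphs\<close>

theorem theorem11:
  fixes n :: nat and G :: "nat pair_pre_digraph" and A U :: "real mat" and x :: "real vec"
  assumes "pair_graph G" and "pverts G = {1..n}"
    and "A = adjacency_matrix n G"
    and "orthonormal_eigenvector_matrix A U"
    and "x \<in> carrier_vec n" and "x \<noteq> 0\<^sub>v n"
  shows "(Factorial_Ring.irreducible (char_poly (adjacency_matrix n G :: rat mat)) \<and>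
            (\<forall>i<n. x $ i \<in> \<rat>) \<longrightarrow>
            vec_space.rank n (walk_matrix A x) = n) \<and>
         (distinct_eigenvalues A \<longrightarrow>
            vec_space.rank n (walk_matrix A x) = l0_norm (transpose_mat U *\<^sub>v x)) \<and>
         (distinct_eigenvalues A \<and> all_minors_nonzero U \<longrightarrow>
            vec_space.rank n (walk_matrix A x) \<ge> n + 1 - l0_norm x)"
proof -
  have A: "A \<in> carrier_mat n n" by (simp add: assms(3) adjacency_matrix_def)
  have U: "U \<in> carrier_mat n n"
    and orth: "\<And>i j. i < n \<Longrightarrow> j < n \<Longrightarrow> col U i \<bullet> col U j = (if i = j then 1 else 0)"
    and ev: "\<And>i. i < n \<Longrightarrow> \<exists>\<mu>. eigenvector A (col U i) \<mu>"
    using assms(4) A by (auto simp: orthonormal_eigenvector_matrix_def)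
  obtain l where l: "\<And>i. i < n \<Longrightarrow> eigenvector A (col U i) (l i)"
    using ev by metis
  interpret pair_graph G by fact
  have "(u, v) \<in> parcs G \<longleftrightarrow> (v, u) \<in> parcs G" for u v
    using arcs_symmetric by blast
  then have "transpose_mat A = A"
    by (intro eq_matI) (auto simp: assms(3) adjacency_matrix_def)
  interpret symmetric_eigenbasis n A U l
  proof
    show "transpose_mat U * U = 1\<^sub>m n" using U orth by (intro eq_matI) auto
  qed (use A U l \<open>transpose_mat A = A\<close> in \<open>auto simp: eigenvector_def\<close>)
  have W: "walk_matrix A x = krylov_matrix A x n"
    using A by (simp add: walk_matrix_def krylov_matrix_def)
  have rational: "vec_space.rank n (walk_matrix A x) = n"
    if "Factorial_Ring.irreducible (char_poly (adjacency_matrix n G :: rat mat))" "\<forall>i<n. x $ i \<in> \<rat>"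
    unfolding W
  proof (rule rank_krylov_rational[OF _ _ that(1) assms(5,6) that(2)])
    show "(adjacency_matrix n G :: rat mat) \<in> carrier_mat n n"
      by (simp add: adjacency_matrix_def)
    show "A = map_mat of_rat (adjacency_matrix n G :: rat mat)"
      unfolding assms(3) by (rule eq_matI) (auto simp: adjacency_matrix_def)
  qed
  have support: "vec_space.rank n (walk_matrix A x) = l0_norm (transpose_mat U *\<^sub>v x)"
    if "distinct_eigenvalues A"
    unfolding W using rank_krylov_eq_transform_support[OF assms(5) inj_on_eigenvalues[OF that]] .
  have "vec_space.rank n (walk_matrix A x) \<ge> n + 1 - l0_norm x"
    if "distinct_eigenvalues A" "all_minors_nonzero U"
    using support[OF that(1)] uncertainty_principle[OF U that(2) assms(5,6)] by simp
  with rational support show ?thesis by blast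
qed

end
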